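(* Let $\mathcal{R}$ be a symmetric $d$-class association scheme with $d\geq 3$, and let $\Gamma$ be its fusing-relations graph. If $\Gamma$ is a connected graph that is not a path, then $\mathcal{R}$ is amorphic.
   Context: A symmetric $d$-class association scheme on a finite set $X$ with $|X|=v$ is a set $\mathcal{R}=\{A_0,A_1,\dots,A_d\}$ of $X\times X$ $01$-matrices ("relations") with $A_0=I$, $A_0+\dots+A_d=J$, $A_i^\top=A_i$, and $A_iA_j=\sum_h p_{ij}^hA_h$ for constants $p_{ij}^h$. For a partition $\pi=\{\pi(0),\dots,\pi(d')\}$ of $\{0,\dots,d\}$ with $\pi(0)=\{0\}$, put $A_{\pi(i)}=\sum_{l\in\pi(i)}A_l$; if $\{A_{\pi(i)}\}$ is again an association scheme it is called a fusion scheme. $\mathcal{R}$ is amorphic if every such partition gives a fusion scheme. A pair $\{A_i,A_j\}$ of non-trivial relations ($i\ne j$, $i,j\ge1$) fuses if replacing $A_i,A_j$ by $A_i+A_j$ (keeping all other relations) yields an association scheme. The fusing-relations graph of $\mathcal{R}$ is the graph on vertex set $\{1,\dots,d\}$ in which $i,j$ are adjacent iff $\{A_i,A_j\}$ fuses. *)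

theory Defs
  imports "HOL-Analysis.Analysis" "HOL-Library.Disjoint_Sets" "Graph_Theory.Digraph_Component"
begin

(* The finite set X is the finite index type 'x.  The relations are required to be non-zero,
   so that a d-class scheme has exactly d non-trivial relations; together with the sum
   condition this makes A 0, ..., A d pairwise distinct. *)
definition association_scheme :: "nat \<Rightarrow> (nat \<Rightarrow> real ^ 'x ^ 'x :: finite) \<Rightarrow> bool" where
  "association_scheme d A \<longleftrightarrow>
     (\<forall>i\<le>d. (\<forall>x y. A i $ x $ y \<in> {0, 1}) \<and> A i \<noteq> 0) \<and>
     A 0 = mat 1 \<and>
     (\<Sum>i\<le>d. A i) = (\<chi> x y. 1) \<and>
     (\<forall>i\<le>d. transpose (A i) = A i) \<and>
     (\<exists>p :: nat \<Rightarrow> nat \<Rightarrow> nat \<Rightarrow> real.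
        \<forall>i\<le>d. \<forall>j\<le>d. A i ** A j = (\<Sum>h\<le>d. p i j h *\<^sub>R A h))"

(* The same notion for an unlabelled set of matrices: fusing relations destroys the labelling. *)
definition is_association_scheme :: "(real ^ 'x ^ 'x :: finite) set \<Rightarrow> bool" where
  "is_association_scheme R \<longleftrightarrow> (\<exists>d A. association_scheme d A \<and> R = A ` {..d})"

definition amorphic :: "nat \<Rightarrow> (nat \<Rightarrow> real ^ 'x ^ 'x :: finite) \<Rightarrow> bool" where
  "amorphic d A \<longleftrightarrow>
     (\<forall>P. partition_on {..d} P \<and> {0} \<in> P \<longrightarrow>
        is_association_scheme ((\<lambda>S. \<Sum>l\<in>S. A l) ` P))"

definition pair_fuses :: "nat \<Rightarrow> (nat \<Rightarrow> real ^ 'x ^ 'x :: finite) \<Rightarrow> nat \<Rightarrow> nat \<Rightarrow> bool" where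
  "pair_fuses d A i j \<longleftrightarrow>
     is_association_scheme (insert (A i + A j) (A ` ({..d} - {i, j})))"

(* A simple graph is represented by the digraph with both orientations of every edge. *)
definition fusing_graph :: "nat \<Rightarrow> (nat \<Rightarrow> real ^ 'x ^ 'x :: finite) \<Rightarrow> nat pair_pre_digraph" where
  "fusing_graph d A =
     \<lparr> pverts = {1..d},
       parcs = {(i, j). i \<in> {1..d} \<and> j \<in> {1..d} \<and> i \<noteq> j \<and> pair_fuses d A i j} \<rparr>"

(* The whole graph is a path: its vertices can be listed without repetition so that
   the edges are exactly the pairs of consecutive vertices. *)
definition is_path_graph :: "'a pair_pre_digraph \<Rightarrow> bool" where
  "is_path_graph G \<longleftrightarrow>
     (\<exists>vs. vs \<noteq> [] \<and> distinct vs \<and> set vs = pverts G \<and>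
        parcs G = {(vs ! k, vs ! Suc k) | k. Suc k < length vs} \<union>
                  {(vs ! Suc k, vs ! k) | k. Suc k < length vs})"

end

theory Submission
  imports Defs
begin

text \<open>
  Put \<open>K\<^sub>i = A\<^sub>i / (A\<^sub>i \<bullet> A\<^sub>i)\<close>, and let \<open>G\<^sub>a\<close> be the primitive idempotents of the
  Bose-Mesner algebra divided by their ranks. Both families are orthogonal for the trace form.
  The pair \<open>i, j\<close> fuses iff the hyperplane \<open>X \<bullet> K\<^sub>i = X \<bullet> K\<^sub>j\<close> of the algebra is closed under
  multiplication, and this holds iff \<open>K\<^sub>i - K\<^sub>j = c (G\<^sub>a - G\<^sub>b)\<close> for some \<open>a, b, c\<close>.
  By orthogonality, edges of the fusing-relations graph sharing a vertex give differences sharing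
  an idempotent. At a vertex with three neighbours the scalars \<open>c\<close> all coincide, so the
  neighbours are adjacent to each other; hence such a vertex forces a connected graph to be
  complete. If all degrees are at least 2, an edge with maximal \<open>\<bar>c\<bar>\<close> has the same scalar as its
  neighbouring edges, which produces either a triangle or a vertex with three neighbours. A
  connected graph in neither of these cases is a path. When the graph is complete, every fusion is
  an intersection of hyperplane subalgebras, hence closed under multiplication.
\<close>

section \<open>Algebras of symmetric matrices\<close>

interpretation matrix_mult: bounded_bilinear
  "(**) :: real ^ 'n ^ 'm \<Rightarrow> real ^ 'p ^ 'n \<Rightarrow> real ^ 'p ^ 'm"
proof -
  have "(X + Y) ** Z = X ** Z + Y ** Z" for X Y :: "real ^ 'n ^ 'm" and Z :: "real ^ 'p ^ 'n"
    by (simp add: vec_eq_iff matrix_matrix_mult_def ring_distribs sum.distrib)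
  then have "bilinear ((**) :: real ^ 'n ^ 'm \<Rightarrow> real ^ 'p ^ 'n \<Rightarrow> real ^ 'p ^ 'm)"
    by (auto simp: bilinear_def matrix_add_ldistrib matrix_scalar_ac
        scalar_matrix_assoc intro!: linearI)
  then show "bounded_bilinear ((**) :: real ^ 'n ^ 'm \<Rightarrow> real ^ 'p ^ 'n \<Rightarrow> real ^ 'p ^ 'm)"
    by (simp add: bilinear_conv_bounded_bilinear)
qed

lemma inner_matrix_mult_left:
  fixes X :: "real ^ 'n ^ 'm" and Y :: "real ^ 'p ^ 'n"
  shows "(X ** Y) \<bullet> Z = Y \<bullet> (transpose X ** Z)"
proof -
  have "(X ** Y) \<bullet> Z = (\<Sum>i\<in>UNIV. \<Sum>j\<in>UNIV. \<Sum>k\<in>UNIV. X $ i $ k * Y $ k $ j * Z $ i $ j)"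
    by (simp add: inner_vec_def matrix_matrix_mult_def sum_distrib_right)
  also have "\<dots> = (\<Sum>k\<in>UNIV. \<Sum>j\<in>UNIV. \<Sum>i\<in>UNIV. X $ i $ k * Y $ k $ j * Z $ i $ j)"
    by (subst sum.swap, subst (2) sum.swap, subst sum.swap) simp
  also have "\<dots> = Y \<bullet> (transpose X ** Z)"
    by (simp add: inner_vec_def matrix_matrix_mult_def transpose_def sum_distrib_left mult_ac)
  finally show ?thesis .
qed

lemma span_matrix_mult_closed:
  fixes B :: "(real ^ 'n ^ 'n) set"
  assumes "\<And>X Y. X \<in> B \<Longrightarrow> Y \<in> B \<Longrightarrow> X ** Y \<in> span B" and "X \<in> span B" and "Y \<in> span B"
  shows "X ** Y \<in> span B"
proof -
  have *: "X ** Y \<in> span B" if "X \<in> B" for X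
    using \<open>Y \<in> span B\<close>
  proof (induction rule: span_induct_alt)
    case base then show ?case by (simp add: span_zero matrix_mult.zero_right)
  next
    case (step c x y)
    then show ?case using that assms(1)
      by (simp add: matrix_mult.add_right matrix_mult.scaleR_right span_add span_scale)
  qed
  show ?thesis
    using \<open>X \<in> span B\<close>
  proof (induction rule: span_induct_alt)
    case base then show ?case by (simp add: span_zero matrix_mult.zero_left)
  next
    case (step c x y)
    then show ?case using *
      by (simp add: matrix_mult.add_left matrix_mult.scaleR_left span_add span_scale)
  qed
qed

locale symmetric_matrix_algebra =
  fixes V :: "(real ^ 'n ^ 'n) set"
  assumes subspace: "subspace V"
    and one: "mat 1 \<in> V"
    and mult: "X \<in> V \<Longrightarrow> Y \<in> V \<Longrightarrow> X ** Y \<in> V"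
    and symmetric: "X \<in> V \<Longrightarrow> transpose X = X"
begin

lemma commute:
  assumes "X \<in> V" "Y \<in> V"
  shows "X ** Y = Y ** X"
  by (metis assms matrix_transpose_mul mult symmetric)

lemma inner_mult: "X \<in> V \<Longrightarrow> (X ** Y) \<bullet> Z = Y \<bullet> (X ** Z)"
  by (simp add: inner_matrix_mult_left symmetric)

lemma inner_mult_one: "X \<in> V \<Longrightarrow> (X ** Y) \<bullet> mat 1 = X \<bullet> Y"
  by (simp add: inner_mult inner_commute[of Y])

text \<open>These are the primitive idempotents, each divided by its rank: \<open>X \<bullet> mat 1\<close> is the trace.\<close>

definition atoms :: "(real ^ 'n ^ 'n) set" where
  "atoms = {G \<in> V. G \<bullet> mat 1 = 1 \<and> (\<forall>X\<in>V. X ** G = (X \<bullet> G) *\<^sub>R G)}"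

lemma atoms_nonzero: "G \<in> atoms \<Longrightarrow> G \<noteq> 0"
  by (auto simp: atoms_def)

text \<open>The product \<open>G ** H\<close> equals \<open>(G \<bullet> H) *\<^sub>R H\<close> and,
  by commutativity, also \<open>(G \<bullet> H) *\<^sub>R G\<close>.\<close>

lemma atoms_orthogonal:
  assumes "G \<in> atoms" "H \<in> atoms" "G \<noteq> H"
  shows "G \<bullet> H = 0"
proof -
  have "(G \<bullet> H) *\<^sub>R H = (G \<bullet> H) *\<^sub>R G"
    using assms commute[of G H] by (auto simp: atoms_def inner_commute)
  then show ?thesis using assms(3) by auto
qed

text \<open>The number \<open>X \<bullet> G\<close> is the eigenvalue of \<open>X\<close> on
  \<open>G\<close>, so pairing with an atom is a character of the algebra.\<close>

lemma atoms_multiplicative: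
  assumes "G \<in> atoms" "X \<in> V" "Y \<in> V"
  shows "(X ** Y) \<bullet> G = (X \<bullet> G) * (Y \<bullet> G)"
proof -
  have "(X ** Y) \<bullet> G = Y \<bullet> (X ** G)"
    using assms by (simp add: inner_mult)
  also have "\<dots> = (X \<bullet> G) * (Y \<bullet> G)"
    using assms by (simp add: atoms_def)
  finally show ?thesis .
qed

text \<open>Two characters agree on a subalgebra: unless \<open>c = 0\<close>, orthogonality to
  \<open>F\<close> means having equal eigenvalues on \<open>G\<close> and \<open>H\<close>.\<close>

lemma hyperplane_closed_if_atoms:
  assumes "G \<in> atoms" "H \<in> atoms" "F = c *\<^sub>R (G - H)"
    and "X \<in> V" "Y \<in> V" "X \<bullet> F = 0" "Y \<bullet> F = 0"
  shows "(X ** Y) \<bullet> F = 0"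
  using assms by (auto simp: atoms_multiplicative inner_diff_right)

text \<open>Taking traces in \<open>X ** E = e *\<^sub>R E\<close> gives
  \<open>X \<bullet> E = e * f\<close>, so dividing \<open>E\<close> by its trace produces the
  eigenvalue required of an atom.\<close>

lemma atomI:
  assumes "E \<in> V" "E \<bullet> mat 1 = f" "f \<noteq> 0" and "\<And>X. X \<in> V \<Longrightarrow> \<exists>e. X ** E = e *\<^sub>R E"
  shows "(1 / f) *\<^sub>R E \<in> atoms"
proof -
  have "X ** E = ((X \<bullet> E) / f) *\<^sub>R E" if "X \<in> V" for X
  proof -
    obtain e where e: "X ** E = e *\<^sub>R E" using assms(4) \<open>X \<in> V\<close> by blast
    have "X \<bullet> E = e * f"
      using inner_mult_one[OF that, of E] assms by (simp add: e)
    then show ?thesis using e \<open>f \<noteq> 0\<close> by simp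
  qed
  then show ?thesis
    using assms subspace
    by (auto simp: atoms_def subspace_scale matrix_mult.scaleR_right)
qed

text \<open>Self-adjointness makes \<open>F\<close> an eigenvector of the hyperplane subalgebra, whence
  \<open>F\<^sup>3 = c F\<^sup>2 + l F\<close> with \<open>l > 0\<close>; up to a scalar, the two atoms are
  \<open>F\<^sup>2 - \<beta> F\<close> and \<open>F\<^sup>2 - \<alpha> F\<close> for the roots \<open>\<alpha>, \<beta>\<close>
  of \<open>t\<^sup>2 - c t - l\<close>.\<close>

lemma atoms_if_hyperplane_closed:
  assumes F: "F \<in> V" "F \<noteq> 0" "F \<bullet> mat 1 = 0"
    and closed: "\<And>X Y. X \<in> V \<Longrightarrow> Y \<in> V \<Longrightarrow> X \<bullet> F = 0 \<Longrightarrow> Y \<bullet> F = 0 \<Longrightarrow> (X ** Y) \<bullet> F = 0"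
  obtains G H c where "G \<in> atoms" "H \<in> atoms" "F = c *\<^sub>R (G - H)"
proof -
  have scale: "c *\<^sub>R X \<in> V" and diff: "X - Y \<in> V" if "X \<in> V" "Y \<in> V" for c X Y
    using that subspace by (auto simp: subspace_scale subspace_diff)
  define f where "f = F \<bullet> F"
  have "f > 0" using F by (simp add: f_def)
  have eigen: "\<exists>\<mu>. Y ** F = \<mu> *\<^sub>R F" if Y: "Y \<in> V" "Y \<bullet> F = 0" for Y
  proof -
    \<comment> \<open>\<open>M\<close> is the part of \<open>Y ** F\<close> orthogonal to
      \<open>F\<close>. Closure for \<open>Y\<close> and \<open>M\<close>, with self-adjointness,
      makes \<open>M\<close> orthogonal to \<open>Y ** F\<close> too, hence to itself.\<close>
    define M where "M = Y ** F - ((Y ** F) \<bullet> F / f) *\<^sub>R F"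
    have "M \<in> V" using Y F by (simp add: M_def diff scale mult)
    have "M \<bullet> F = 0" using \<open>f > 0\<close> by (simp add: M_def inner_diff_left f_def)
    then have "(Y ** M) \<bullet> F = 0" using closed Y \<open>M \<in> V\<close> by blast
    then have "M \<bullet> (Y ** F) = 0" using Y by (simp add: inner_mult)
    then have "M \<bullet> M = 0"
      using \<open>M \<bullet> F = 0\<close> by (subst (2) M_def) (simp add: inner_diff_right)
    then show ?thesis by (auto simp: M_def)
  qed
  define c where "c = (F ** F) \<bullet> F / f"
  define b where "b = F ** F - c *\<^sub>R F"
  have b: "b \<in> V" "b \<bullet> F = 0"
    using F \<open>f > 0\<close> by (auto simp: b_def c_def f_def diff scale mult inner_diff_left)
  have sq: "F ** F = b + c *\<^sub>R F" by (simp add: b_def)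
  obtain l where l: "b ** F = l *\<^sub>R F" using eigen b by blast
  have "b ** b = l *\<^sub>R b"
  proof -
    have "b ** b = (b ** F) ** F - c *\<^sub>R (b ** F)"
      by (subst (2) b_def)
        (simp add: matrix_mult.diff_right matrix_mult.scaleR_right matrix_mul_assoc)
    then show ?thesis
      unfolding l by (simp add: b_def matrix_mult.scaleR_left scaleR_diff_right mult.commute)
  qed
  \<comment> \<open>\<open>F\<close> has trace zero, so \<open>b\<close> has the trace
    \<open>f\<close> of \<open>F ** F\<close>. Hence \<open>b\<close> is nonzero, and taking traces
    in \<open>b ** b = l *\<^sub>R b\<close> shows that \<open>l\<close> is positive.\<close>
  moreover have "b \<bullet> mat 1 = f"
    using F by (simp add: b_def inner_diff_left inner_mult_one f_def)
  ultimately have "b \<bullet> b = l * f"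
    using inner_mult_one[of b b] b by simp
  moreover have "b \<bullet> b > 0"
    using \<open>b \<bullet> mat 1 = f\<close> \<open>f > 0\<close> by auto
  ultimately have "l > 0" using \<open>f > 0\<close> by (simp add: zero_less_mult_iff)
  define s where "s = sqrt (c\<^sup>2 + 4 * l)"
  have s: "s > 0" "s * s = c * c + 4 * l"
    using \<open>l > 0\<close> by (auto simp: s_def power2_eq_square add_nonneg_pos)
  have atom: "(1 / f) *\<^sub>R (F ** F - \<beta> *\<^sub>R F) \<in> atoms"
    if ab: "\<alpha> + \<beta> = c" "\<alpha> * \<beta> = - l" for \<alpha> \<beta>
  proof (rule atomI)
    let ?E = "F ** F - \<beta> *\<^sub>R F"
    show "?E \<in> V" using F by (simp add: diff scale mult)
    show "?E \<bullet> mat 1 = f" using F by (simp add: inner_diff_left inner_mult_one f_def)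
    show "f \<noteq> 0" using \<open>f > 0\<close> by simp
    have FE: "F ** ?E = \<alpha> *\<^sub>R ?E"
    proof -
      have "F ** ?E = F ** b + (c - \<beta>) *\<^sub>R (F ** F)"
        by (subst sq) (simp add: matrix_mult.diff_right matrix_mult.add_right
            matrix_mult.scaleR_right scaleR_diff_left)
      also have "F ** b = (- (\<alpha> * \<beta>)) *\<^sub>R F"
        using commute[OF F(1) b(1)] ab by (simp add: l)
      also have "c - \<beta> = \<alpha>" using ab by simp
      finally show ?thesis by (simp add: scaleR_diff_right)
    qed
    \<comment> \<open>Every \<open>X\<close> is a hyperplane member \<open>Y\<close> plus a multiple
      of \<open>F\<close>. \<open>Y\<close> scales \<open>?E\<close> because it scales
      \<open>F\<close>; \<open>F\<close> scales \<open>?E\<close> by \<open>FE\<close>.\<close>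
    fix X assume X: "X \<in> V"
    define t where "t = X \<bullet> F / f"
    define Y where "Y = X - t *\<^sub>R F"
    have "Y \<in> V" "Y \<bullet> F = 0"
      using X F \<open>f > 0\<close> by (auto simp: Y_def t_def f_def diff scale inner_diff_left)
    then obtain \<mu> where \<mu>: "Y ** F = \<mu> *\<^sub>R F" using eigen by blast
    have "X ** ?E = Y ** ?E + t *\<^sub>R (F ** ?E)"
      by (simp add: Y_def matrix_mult.diff_left matrix_mult.scaleR_left)
    also have "Y ** ?E = \<mu> *\<^sub>R ?E"
      by (simp add: matrix_mult.diff_right matrix_mult.scaleR_right matrix_mul_assoc \<mu>
          matrix_mult.scaleR_left scaleR_diff_right mult.commute)
    finally have "X ** ?E = (\<mu> + t * \<alpha>) *\<^sub>R ?E"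
      by (simp add: FE scaleR_add_left)
    then show "\<exists>e. X ** ?E = e *\<^sub>R ?E" by blast
  qed
  let ?\<alpha> = "(c + s) / 2" and ?\<beta> = "(c - s) / 2"
  have sum: "?\<alpha> + ?\<beta> = c" and prod: "?\<alpha> * ?\<beta> = - l"
    using s by (auto simp: field_simps)
  let ?G = "(1 / f) *\<^sub>R (F ** F - ?\<beta> *\<^sub>R F)" and ?H = "(1 / f) *\<^sub>R (F ** F - ?\<alpha> *\<^sub>R F)"
  have "?G - ?H = (s / f) *\<^sub>R F"
  proof -
    have "?G - ?H = (1 / f) *\<^sub>R ((?\<alpha> - ?\<beta>) *\<^sub>R F)"
      unfolding scaleR_diff_right[symmetric] by (simp add: algebra_simps)
    also have "?\<alpha> - ?\<beta> = s" by (simp add: field_simps)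
    finally show ?thesis by simp
  qed
  then have "F = (f / s) *\<^sub>R (?G - ?H)" using s \<open>f > 0\<close> by simp
  moreover have "?G \<in> atoms" using atom[OF sum prod] .
  moreover have "?H \<in> atoms" using atom[of ?\<beta> ?\<alpha>] sum prod by (simp add: ac_simps)
  ultimately show ?thesis using that by blast
qed

end

section \<open>Proportional differences in two orthogonal families\<close>

text \<open>Only orthogonality is used in this section. \<open>K\<close> will be the rescaled
  non-trivial relations and \<open>N\<close> the atoms.\<close>

locale dual_orthogonal_families =
  fixes K :: "'i \<Rightarrow> 'v :: real_inner" and I :: "'i set" and N :: "'v set"
  assumes K_orthogonal: "i \<in> I \<Longrightarrow> j \<in> I \<Longrightarrow> i \<noteq> j \<Longrightarrow> K i \<bullet> K j = 0"
    and K_nonzero: "i \<in> I \<Longrightarrow> K i \<noteq> 0"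
    and N_orthogonal: "G \<in> N \<Longrightarrow> H \<in> N \<Longrightarrow> G \<noteq> H \<Longrightarrow> G \<bullet> H = 0"
    and N_nonzero: "G \<in> N \<Longrightarrow> G \<noteq> 0"
begin

text \<open>Exchanging \<open>G\<close> and \<open>H\<close> negates \<open>c\<close>, so a
  representation is unique only up to this exchange.\<close>

definition diff_repr :: "'i \<Rightarrow> 'i \<Rightarrow> 'v \<Rightarrow> 'v \<Rightarrow> real \<Rightarrow> bool" where
  "diff_repr i j G H c \<longleftrightarrow> G \<in> N \<and> H \<in> N \<and> K i - K j = c *\<^sub>R (G - H)"

definition adj :: "'i \<Rightarrow> 'i \<Rightarrow> bool" where
  "adj i j \<longleftrightarrow> i \<in> I \<and> j \<in> I \<and> i \<noteq> j \<and> (\<exists>G H c. diff_repr i j G H c)"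

lemma adjD: "adj i j \<Longrightarrow> i \<in> I" "adj i j \<Longrightarrow> j \<in> I" "adj i j \<Longrightarrow> i \<noteq> j"
  by (auto simp: adj_def)

lemma K_inj: "i \<in> I \<Longrightarrow> j \<in> I \<Longrightarrow> i \<noteq> j \<Longrightarrow> K i \<noteq> K j"
  by (metis K_nonzero K_orthogonal inner_eq_zero_iff)

lemma diff_repr_rev: "diff_repr i j G H c \<longleftrightarrow> diff_repr j i H G c"
  unfolding diff_repr_def by (metis minus_diff_eq scaleR_minus_right)

lemma diff_repr_swap: "diff_repr i j G H c \<longleftrightarrow> diff_repr i j H G (- c)"
  unfolding diff_repr_def by (auto simp: algebra_simps)

lemma adj_sym: "adj i j \<longleftrightarrow> adj j i"
  unfolding adj_def using diff_repr_rev by blast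

lemma diff_repr_nonzero:
  assumes "diff_repr i j G H c" "i \<in> I" "j \<in> I" "i \<noteq> j"
  shows "c \<noteq> 0" "G \<noteq> H"
  using assms K_inj[of i j] by (auto simp: diff_repr_def)

text \<open>Pairing with \<open>G\<close> leaves a nonzero number on the left, so \<open>G\<close>
  is one of \<open>G'\<close> and \<open>H'\<close>. The same pairing gives the scalar, and
  cancellation the remaining vector.\<close>

lemma scaled_diff_unique:
  assumes N: "G \<in> N" "H \<in> N" "G' \<in> N" "H' \<in> N"
    and eq: "c *\<^sub>R (G - H) = c' *\<^sub>R (G' - H')" and "c \<noteq> 0" "G \<noteq> H"
  shows "G = G' \<and> H = H' \<and> c = c' \<or> G = H' \<and> H = G' \<and> c = - c'"
proof -
  have 1: "c * (G \<bullet> G) = c' * (G' \<bullet> G - H' \<bullet> G)"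
    using arg_cong[OF eq, of "\<lambda>x. x \<bullet> G"] N_orthogonal[of H G] N \<open>G \<noteq> H\<close>
    by (simp add: inner_diff_left)
  have "G \<bullet> G \<noteq> 0" using N N_nonzero by auto
  then have nz: "c' * (G' \<bullet> G - H' \<bullet> G) \<noteq> 0" unfolding 1[symmetric] using \<open>c \<noteq> 0\<close> by simp
  then have "G' \<noteq> H'" by auto
  consider "G = G'" | "G = H'"
    using nz N N_orthogonal by fastforce
  then show ?thesis
  proof cases
    case 1
    then have "c = c'"
      using \<open>c * (G \<bullet> G) = _\<close> N_orthogonal[of H' G] N \<open>G' \<noteq> H'\<close> \<open>G \<bullet> G \<noteq> 0\<close> by auto
    then show ?thesis using eq 1 \<open>c \<noteq> 0\<close> by auto
  next
    case 2
    have eq': "c' *\<^sub>R (G' - H') = (- c') *\<^sub>R (H' - G')" by (simp add: scaleR_diff_right)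
    have "c * (G \<bullet> G) = (- c') * (G \<bullet> G)"
      using \<open>c * (G \<bullet> G) = _\<close> N_orthogonal[of G' H'] N \<open>G' \<noteq> H'\<close> 2 by simp
    then have "c = - c'" using \<open>G \<bullet> G \<noteq> 0\<close> unfolding mult_cancel_right by blast
    then have "c *\<^sub>R (G - H) = c *\<^sub>R (G - G')" using eq eq' 2 by simp
    then show ?thesis using 2 \<open>c = - c'\<close> \<open>c \<noteq> 0\<close> by simp
  qed
qed

lemma diff_repr_unique:
  assumes "diff_repr i j G H c" "diff_repr i j G' H' c'" "i \<in> I" "j \<in> I" "i \<noteq> j"
  shows "G = G' \<and> H = H' \<and> c = c' \<or> G = H' \<and> H = G' \<and> c = - c'"
  using scaled_diff_unique[of G H G' H' c c'] diff_repr_nonzero[OF assms(1,3,4,5)] assms(1,2)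
  by (simp add: diff_repr_def)

section \<open>Edges sharing a vertex\<close>

lemma inner_N_diff:
  assumes "G \<in> N" "H \<in> N" "H' \<in> N" "G \<noteq> H" "G \<noteq> H'" "H \<noteq> H'"
  shows "(G - H) \<bullet> (G - H') = G \<bullet> G"
  using assms N_orthogonal by (simp add: inner_diff_left inner_diff_right)

text \<open>The two differences have inner product \<open>K j \<bullet> K j\<close>, which is
  positive, so their pairs in \<open>N\<close> meet. The pairs cannot coincide, as
  \<open>K j - K i\<close> and \<open>K j - K k\<close> are not proportional. Exchanges put the
  common vector first.\<close>

lemma incident_diffs:
  assumes "adj j i" "adj j k" "i \<noteq> k"
  obtains G H1 H2 c1 c2 where "diff_repr j i G H1 c1" "diff_repr j k G H2 c2"
    "G \<noteq> H1" "G \<noteq> H2" "H1 \<noteq> H2" "c1 * c2 * (G \<bullet> G) = K j \<bullet> K j"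
proof -
  note I = adjD[OF assms(1)] adjD[OF assms(2)]
  obtain G H c where r: "diff_repr j i G H c" using assms(1) by (auto simp: adj_def)
  obtain G' H' c' where r': "diff_repr j k G' H' c'" using assms(2) by (auto simp: adj_def)
  note nz = diff_repr_nonzero[OF r I(1-3)] and nz' = diff_repr_nonzero[OF r' I(4-6)]
  have N: "G \<in> N" "H \<in> N" "G' \<in> N" "H' \<in> N" using r r' by (auto simp: diff_repr_def)
  have inner: "(K j - K i) \<bullet> (K j - K k) = K j \<bullet> K j"
    using I assms(3) K_orthogonal by (simp add: inner_diff_left inner_diff_right)
  have pos: "K j \<bullet> K j > 0" using I K_nonzero by simp
  have "c * c' * ((G - H) \<bullet> (G' - H')) = K j \<bullet> K j"
    unfolding inner[symmetric] using r r' by (simp add: diff_repr_def)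
  then have "(G - H) \<bullet> (G' - H') \<noteq> 0" using pos by auto
  then have common: "G = G' \<or> G = H' \<or> H = G' \<or> H = H'"
    using N_orthogonal N by (fastforce simp: inner_diff_left inner_diff_right)
  have False if "{G, H} = {G', H'}"
  proof -
    have "\<exists>t. K j - K k = t *\<^sub>R (K j - K i)"
    proof -
      have "G' - H' = 1 *\<^sub>R (G - H) \<or> G' - H' = (- 1) *\<^sub>R (G - H)"
        using that by (auto simp: doubleton_eq_iff)
      then obtain e where "G' - H' = e *\<^sub>R (G - H)" by blast
      then have "K j - K k = (c' * e / c) *\<^sub>R (K j - K i)"
        using r r' nz by (simp add: diff_repr_def)
      then show ?thesis by blast
    qed
    then obtain t where t: "K j - K k = t *\<^sub>R (K j - K i)" by blast
    have "K i \<bullet> K i \<noteq> 0" using I K_nonzero by simp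
    then have "t = 0"
      using arg_cong[OF t, of "\<lambda>x. x \<bullet> K i"] I assms(3) K_orthogonal
      by (auto simp: inner_diff_left)
    then show False using t K_inj I by auto
  qed
  then have "\<exists>G1 H1 H2 c1 c2. diff_repr j i G1 H1 c1 \<and> diff_repr j k G1 H2 c2 \<and>
      G1 \<noteq> H1 \<and> G1 \<noteq> H2 \<and> H1 \<noteq> H2"
    using common r r' nz nz' diff_repr_swap by blast
  then obtain G1 H1 H2 c1 c2 where *: "diff_repr j i G1 H1 c1" "diff_repr j k G1 H2 c2"
    "G1 \<noteq> H1" "G1 \<noteq> H2" "H1 \<noteq> H2" by blast
  have "K j \<bullet> K j = c1 * c2 * ((G1 - H1) \<bullet> (G1 - H2))"
    unfolding inner[symmetric] using * by (simp add: diff_repr_def)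
  also have "(G1 - H1) \<bullet> (G1 - H2) = G1 \<bullet> G1"
    using * by (intro inner_N_diff) (auto simp: diff_repr_def)
  finally show ?thesis using that * by simp
qed

text \<open>When the two representations are subtracted, \<open>G\<close> cancels because the
  scalars agree.\<close>

lemma adj_from_equal_scalars:
  assumes "diff_repr j i G H1 c" "diff_repr j k G H2 c" "i \<in> I" "k \<in> I" "i \<noteq> k"
  shows "adj i k"
proof -
  have "K i - K k = (K j - K k) - (K j - K i)" by simp
  also have "\<dots> = c *\<^sub>R (H1 - H2)"
    using assms by (simp only: diff_repr_def) (simp add: scaleR_diff_right)
  finally show ?thesis using assms unfolding adj_def diff_repr_def by blast
qed

text \<open>The third neighbour \<open>l\<close> compares the scalars of the other two. If all three
  pairs in \<open>N\<close> share \<open>G\<close>, then \<open>c1 * d3\<close> and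
  \<open>c2 * d3\<close> are both the quotient of \<open>K j \<bullet> K j\<close> by
  \<open>G \<bullet> G\<close>, so \<open>c1 = c2\<close>.\<close>

lemma claw_adj:
  assumes "adj j i" "adj j k" "adj j l" "i \<noteq> k" "i \<noteq> l" "k \<noteq> l"
  shows "adj i k"
proof -
  note I = adjD[OF assms(1)] adjD[OF assms(2)] adjD[OF assms(3)]
  obtain G H1 H2 c1 c2 where r12: "diff_repr j i G H1 c1" "diff_repr j k G H2 c2"
    and ne: "G \<noteq> H1" "G \<noteq> H2" "H1 \<noteq> H2" and c12: "c1 * c2 * (G \<bullet> G) = K j \<bullet> K j"
    using incident_diffs[OF assms(1,2,4)] .
  obtain G' H1' H3 d1 d3 where r13: "diff_repr j i G' H1' d1" "diff_repr j l G' H3 d3"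
    and ne': "G' \<noteq> H1'" "G' \<noteq> H3" "H1' \<noteq> H3" and c13: "d1 * d3 * (G' \<bullet> G') = K j \<bullet> K j"
    using incident_diffs[OF assms(1,3,5)] .
  have N: "G \<in> N" "H1 \<in> N" "H2 \<in> N" "H3 \<in> N"
    using r12 r13 by (auto simp: diff_repr_def)
  have Kpos: "K j \<bullet> K j > 0" using I K_nonzero by simp
  have Npos: "G \<bullet> G > 0" "H1 \<bullet> H1 > 0" "H2 \<bullet> H2 > 0" using N N_nonzero by auto
  have ip: "(K j - K k) \<bullet> (K j - K l) = K j \<bullet> K j"
    using I assms K_orthogonal by (simp add: inner_diff_left inner_diff_right)
  have c12': "c1 * c2 > 0" using c12 Kpos Npos by (metis zero_less_mult_pos2)
  consider "G' = G" "H1' = H1" "d1 = c1" | "G' = H1" "H1' = G" "d1 = - c1"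
    using diff_repr_unique[OF r13(1) r12(1)] I by auto
  then show ?thesis
  proof cases
    case 1
    have "c1 * d3 * (G \<bullet> G) = K j \<bullet> K j" using c13 1 by simp
    moreover have "c2 * d3 * ((G - H2) \<bullet> (G - H3)) = K j \<bullet> K j"
      unfolding ip[symmetric] using r12 r13 1 by (simp add: diff_repr_def)
    moreover have "(G - H2) \<bullet> (G - H3) = G \<bullet> G"
    proof (rule inner_N_diff)
      show "H2 \<noteq> H3"
      proof
        assume "H2 = H3"
        then have "K j - K l = (d3 / c2) *\<^sub>R (K j - K k)"
          using r12 r13 1 diff_repr_nonzero[OF r12(2)] I by (simp add: diff_repr_def)
        from arg_cong[OF this, of "\<lambda>x. x \<bullet> K k"] have "d3 / c2 = 0"
          using I assms K_orthogonal K_nonzero[of k] by (auto simp: inner_diff_left)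
        then show False using diff_repr_nonzero[OF r13(2)] diff_repr_nonzero[OF r12(2)] I by simp
      qed
    qed (use N ne ne' 1 in auto)
    ultimately have "(c1 - c2) * d3 * (G \<bullet> G) = 0" by (simp add: left_diff_distrib)
    moreover have "d3 \<noteq> 0" using diff_repr_nonzero[OF r13(2)] I by simp
    ultimately have "c1 = c2" using Npos by simp
    then show ?thesis using adj_from_equal_scalars r12 I assms(4) by blast
  next
    \<comment> \<open>Here the three differences would form a triangle in \<^term>\<open>N\<close>; the signs forbid it.\<close>
    case 2
    have "c1 * d3 < 0"
      using c13 2 Kpos Npos by (metis minus_mult_left neg_0_less_iff_less zero_less_mult_pos2)
    have e: "c2 * d3 * ((G - H2) \<bullet> (H1 - H3)) = K j \<bullet> K j"
      unfolding ip[symmetric] using r12 r13 2 by (simp add: diff_repr_def)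
    have "(G - H2) \<bullet> (H1 - H3) = (if H2 = H3 then H2 \<bullet> H2 else 0)"
      using N_orthogonal N ne ne' 2 by (auto simp: inner_diff_left inner_diff_right)
    then have "c2 * d3 > 0"
      using e Kpos Npos by (metis mult_zero_right less_irrefl zero_less_mult_pos2)
    \<comment> \<open>The product of \<open>c1 * c2\<close>, \<open>c1 * d3\<close> and
      \<open>c2 * d3\<close> is a square, yet exactly one factor is negative.\<close>
    with \<open>c1 * d3 < 0\<close> c12' show ?thesis
      by (auto simp: zero_less_mult_iff mult_less_0_iff)
  qed
qed

text \<open>The absolute value removes the sign ambiguity, so the choice is immaterial on adjacent
  pairs; without a representation the value is unspecified.\<close>

definition weight :: "'i \<Rightarrow> 'i \<Rightarrow> real" where
  "weight i j = \<bar>SOME c. \<exists>G H. diff_repr i j G H c\<bar>"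

lemma weight_eq:
  assumes "diff_repr i j G H c" "i \<in> I" "j \<in> I" "i \<noteq> j"
  shows "weight i j = \<bar>c\<bar>"
proof -
  have "\<exists>G H. diff_repr i j G H (SOME c. \<exists>G H. diff_repr i j G H c)"
    using assms(1) by (intro someI[of "\<lambda>c. \<exists>G H. diff_repr i j G H c"]) blast
  then obtain G' H' where "diff_repr i j G' H' (SOME c. \<exists>G H. diff_repr i j G H c)" by blast
  from diff_repr_unique[OF assms(1) this assms(2-4)] show ?thesis
    unfolding weight_def by linarith
qed

text \<open>Comparing norms, the scalar of an edge is a weighted mean of the scalars of its two
  neighbouring edges; hence a maximal one agrees with both.\<close>

lemma max_weight_adj:
  assumes "adj j i" "adj j k" "adj k l" "i \<noteq> k" "l \<noteq> j" "i \<noteq> l"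
    and "weight j i \<le> weight j k" "weight k l \<le> weight j k"
  shows "adj i k"
proof -
  note I = adjD[OF assms(1)] adjD[OF assms(2)] adjD[OF assms(3)]
  obtain G H1 H c1 c where r1: "diff_repr j i G H1 c1" "diff_repr j k G H c"
    and ne: "G \<noteq> H1" "G \<noteq> H" "H1 \<noteq> H" and c1: "c1 * c * (G \<bullet> G) = K j \<bullet> K j"
    using incident_diffs[OF assms(1,2,4)] .
  have kj: "adj k j" "j \<noteq> l" using assms adj_sym by auto
  obtain G' H' H2 c' c2 where r2: "diff_repr k j G' H' c'" "diff_repr k l G' H2 c2"
    and ne': "G' \<noteq> H'" "G' \<noteq> H2" "H' \<noteq> H2" and c2: "c' * c2 * (G' \<bullet> G') = K k \<bullet> K k"
    using incident_diffs[OF kj(1) assms(3) kj(2)] .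
  have N: "G \<in> N" "H1 \<in> N" "H \<in> N" "H2 \<in> N"
    using r1 r2 by (auto simp: diff_repr_def)
  have nz: "c1 \<noteq> 0" "c2 \<noteq> 0" "c \<noteq> 0"
    using diff_repr_nonzero[OF r1(1)] diff_repr_nonzero[OF r2(2)] diff_repr_nonzero[OF r1(2)] I
    by auto
  have pos: "G \<bullet> G > 0" "H \<bullet> H > 0" using N N_nonzero by auto
  have "diff_repr j k H' G' c'" using r2(1) diff_repr_rev by blast
  \<comment> \<open>Either the outer edges share different vectors \<open>G\<close> and
    \<open>H\<close> with the middle edge, or both share \<open>G\<close> with it.\<close>
  from diff_repr_unique[OF this r1(2)] consider "H' = G" "G' = H" "c' = c" | "G' = G" "H' = H"
    using I by auto
  then show ?thesis
  proof cases
    case 1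
    have sum: "K j \<bullet> K j + K k \<bullet> K k = c * c * (G \<bullet> G + H \<bullet> H)"
    proof -
      have "K j \<bullet> K j + K k \<bullet> K k = (K j - K k) \<bullet> (K j - K k)"
        using I K_orthogonal by (simp add: inner_diff_left inner_diff_right)
      also have "\<dots> = c * c * ((G - H) \<bullet> (G - H))"
        using r1 by (simp add: diff_repr_def)
      also have "(G - H) \<bullet> (G - H) = G \<bullet> G + H \<bullet> H"
        using N N_orthogonal ne by (simp add: inner_diff_left inner_diff_right)
      finally show ?thesis .
    qed
    have "\<bar>c1\<bar> \<le> \<bar>c\<bar>" "\<bar>c2\<bar> \<le> \<bar>c\<bar>"
      using assms(7,8) weight_eq[OF r1(1)] weight_eq[OF r1(2)] weight_eq[OF r2(2)] I by auto
    moreover have "x * c \<le> c * c" if "\<bar>x\<bar> \<le> \<bar>c\<bar>" for x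
      using mult_right_mono[OF that, of "\<bar>c\<bar>"] abs_ge_self[of "x * c"] by (simp add: abs_mult)
    ultimately have le: "c1 * c \<le> c * c" "c * c2 \<le> c * c" by (auto simp: mult.commute)
    \<comment> \<open>The norm identity minus the two incidence identities: both summands are
      nonnegative, so each vanishes.\<close>
    have "(c * c - c1 * c) * (G \<bullet> G) + (c * c - c * c2) * (H \<bullet> H) = 0"
      using sum c1 c2 1 by (simp add: algebra_simps)
    moreover have "(c * c - c1 * c) * (G \<bullet> G) \<ge> 0" "(c * c - c * c2) * (H \<bullet> H) \<ge> 0"
      using le pos by auto
    ultimately have "(c * c - c1 * c) * (G \<bullet> G) = 0" by linarith
    then have "c1 = c" using pos nz by simp
    then show ?thesis using adj_from_equal_scalars r1 I assms(4) by blast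
  next
    case 2
    \<comment> \<open>The outer edges have no common vertex, so their differences are orthogonal;
      sharing \<open>G\<close> with the same position would make the inner product nonzero.\<close>
    have "0 = (K j - K i) \<bullet> (K k - K l)"
      using I assms kj K_orthogonal by (simp add: inner_diff_left inner_diff_right)
    also have "\<dots> = c1 * c2 * ((G - H1) \<bullet> (G - H2))"
      using r1 r2 2 by (simp add: diff_repr_def)
    finally have "(G - H1) \<bullet> (G - H2) = 0" using nz by simp
    moreover have "(G - H1) \<bullet> (G - H2) = G \<bullet> G + (if H1 = H2 then H1 \<bullet> H1 else 0)"
      using N N_orthogonal ne ne' 2 by (auto simp: inner_diff_left inner_diff_right)
    ultimately show ?thesis using pos by (auto split: if_splits simp: add_nonneg_eq_0_iff)
  qed
qed

text \<open>By \<open>claw_adj\<close> the neighbours of \<open>v\<close> are pairwise adjacent.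
  With \<open>v\<close> they form a set closed under adjacency, which is everything by connectivity,
  stated here as the absence of proper nonempty closed sets.\<close>

lemma claw_complete:
  assumes conn: "\<And>S. S \<subseteq> I \<Longrightarrow> S \<noteq> {} \<Longrightarrow> (\<And>i j. i \<in> S \<Longrightarrow> adj i j \<Longrightarrow> j \<in> S) \<Longrightarrow> S = I"
    and "adj v x" "adj v y" "adj v z" "x \<noteq> y" "x \<noteq> z" "y \<noteq> z"
    and "i \<in> I" "k \<in> I" "i \<noteq> k"
  shows "adj i k"
proof -
  have nbrs: "adj p q" if "adj v p" "adj v q" "p \<noteq> q" for p q
  proof -
    obtain r where "adj v r" "p \<noteq> r" "q \<noteq> r" using assms by metis
    then show ?thesis using claw_adj that by blast
  qed
  have "insert v {u. adj v u} = I"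
  proof (rule conn)
    fix u w assume u: "u \<in> insert v {u. adj v u}" and uw: "adj u w"
    show "w \<in> insert v {u. adj v u}"
    proof (cases "u = v \<or> w = v \<or> adj v w")
      case True then show ?thesis using uw by auto
    next
      case False
      \<comment> \<open>Now \<open>v\<close>, \<open>w\<close> and \<open>p\<close> are three
        neighbours of \<open>u\<close>, so \<open>claw_adj\<close> at \<open>u\<close> joins
        \<open>v\<close> to \<open>w\<close>.\<close>
      obtain p where p: "adj v p" "p \<noteq> u" using assms by metis
      have "adj u p" "adj u v" using nbrs p u False adj_sym by auto
      then have "adj v w" using claw_adj[of u v w p] uw False p adjD by blast
      then show ?thesis by simp
    qed
  qed (use adjD assms(2) in auto)
  then have "i = v \<or> adj v i" "k = v \<or> adj v k" using assms(8,9) by auto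
  then show ?thesis using nbrs \<open>i \<noteq> k\<close> adj_sym[of i v] by auto
qed

text \<open>Otherwise no vertex has three neighbours. An edge \<open>j k\<close> of maximal weight
  lies in a triangle, which is closed because its vertices already have two neighbours each; so it
  is the whole graph, and complete.\<close>

lemma min_degree_two_complete:
  assumes conn: "\<And>S. S \<subseteq> I \<Longrightarrow> S \<noteq> {} \<Longrightarrow> (\<And>i j. i \<in> S \<Longrightarrow> adj i j \<Longrightarrow> j \<in> S) \<Longrightarrow> S = I"
    and deg: "\<And>i. i \<in> I \<Longrightarrow> \<exists>x y. adj i x \<and> adj i y \<and> x \<noteq> y"
    and "finite I" "p \<in> I" "q \<in> I" "p \<noteq> q"
  shows "adj p q"
proof (rule ccontr)
  assume "\<not> adj p q"
  then have no_claw: "x = y \<or> x = z \<or> y = z" if "adj v x" "adj v y" "adj v z" for v x y z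
    using claw_complete[OF conn] that assms(4-6) by blast
  define E where "E = {(u, w). adj u w}"
  have "E \<subseteq> I \<times> I" using adjD by (auto simp: E_def)
  then have "finite E" using \<open>finite I\<close> finite_subset by blast
  moreover have "E \<noteq> {}" using deg[OF \<open>p \<in> I\<close>] by (auto simp: E_def)
  ultimately have "Max (case_prod weight ` E) \<in> case_prod weight ` E" by simp
  then obtain e where e: "e \<in> E" "Max (case_prod weight ` E) = case_prod weight e" by blast
  obtain j k where [simp]: "e = (j, k)" by (cases e)
  have jk: "adj j k" using e by (simp add: E_def)
  have max: "weight u w \<le> weight j k" if "adj u w" for u w
  proof -
    have "weight u w \<in> case_prod weight ` E" using that by (force simp: E_def)
    then show ?thesis using Max_ge[of "case_prod weight ` E"] \<open>finite E\<close> e(2) by simp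
  qed
  obtain i where i: "adj j i" "i \<noteq> k" using deg adjD(1)[OF jk] by metis
  obtain l where l: "adj k l" "l \<noteq> j" using deg adjD(2)[OF jk] by metis
  have "adj i k"
  proof (cases "i = l")
    case True then show ?thesis using l adj_sym by blast
  next
    case False then show ?thesis using max_weight_adj[of j i k l] i jk l max by auto
  qed
  then have tri: "adj j i" "adj i j" "adj j k" "adj k j" "adj i k" "adj k i"
    using i jk adj_sym by auto
  have "{i, j, k} = I"
  proof (rule conn)
    show "w \<in> {i, j, k}" if "u \<in> {i, j, k}" "adj u w" for u w
      using that tri no_claw adjD by (metis insert_iff singletonD)
  qed (use tri adjD in auto)
  then show False using tri assms(4-6) \<open>\<not> adj p q\<close> by auto
qed

end

section \<open>Connected graphs that are not paths\<close>

text \<open>If no vertex has three neighbours, take a longest path. Its inner vertices have both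
  neighbours on it and its ends cannot be extended, so it covers \<open>I\<close> by connectivity. A
  further edge can only join its ends, and the resulting cycle gives every vertex two
  neighbours.\<close>

lemma connected_path_or_claw_or_min_degree_two:
  fixes E :: "'i rel"
  assumes "finite I" "I \<noteq> {}" "E \<subseteq> I \<times> I" "sym E" "irrefl E"
    and conn: "\<And>S. S \<subseteq> I \<Longrightarrow> S \<noteq> {} \<Longrightarrow> (\<And>i j. i \<in> S \<Longrightarrow> (i, j) \<in> E \<Longrightarrow> j \<in> S) \<Longrightarrow> S = I"
  obtains
    (path) vs where "vs \<noteq> []" "distinct vs" "set vs = I"
      "E = {(vs ! k, vs ! Suc k) | k. Suc k < length vs} \<union>
           {(vs ! Suc k, vs ! k) | k. Suc k < length vs}"
  | (claw) v x y z where "(v, x) \<in> E" "(v, y) \<in> E" "(v, z) \<in> E" "x \<noteq> y" "x \<noteq> z" "y \<noteq> z"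
  | (deg) "\<And>i. i \<in> I \<Longrightarrow> \<exists>x y. (i, x) \<in> E \<and> (i, y) \<in> E \<and> x \<noteq> y"
proof (cases "\<exists>v x y z. (v, x) \<in> E \<and> (v, y) \<in> E \<and> (v, z) \<in> E \<and> x \<noteq> y \<and> x \<noteq> z \<and> y \<noteq> z")
  case True then show ?thesis using claw by blast
next
  case no_claw: False
  have sym: "(u, w) \<in> E \<longleftrightarrow> (w, u) \<in> E" for u w using \<open>sym E\<close> by (auto dest: symD)
  define P where "P vs \<longleftrightarrow> vs \<noteq> [] \<and> distinct vs \<and> set vs \<subseteq> I \<and>
      (\<forall>k. Suc k < length vs \<longrightarrow> (vs ! k, vs ! Suc k) \<in> E)" for vs
  obtain v where "v \<in> I" using \<open>I \<noteq> {}\<close> by blast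
  have "P [v]" using \<open>v \<in> I\<close> by (simp add: P_def)
  moreover have "length vs \<le> card I" if "P vs" for vs
    using that card_mono[OF \<open>finite I\<close>, of "set vs"] by (simp add: P_def distinct_card)
  ultimately obtain vs where vs: "P vs" and longest: "\<And>ws. P ws \<Longrightarrow> length ws \<le> length vs"
    using ex_has_greatest_nat[of P "[v]" length "Suc (card I)"] by (metis less_Suc_eq_le)
  let ?n = "length vs"
  have step: "(vs ! k, vs ! Suc k) \<in> E" "(vs ! Suc k, vs ! k) \<in> E" if "Suc k < ?n" for k
    using vs that sym by (auto simp: P_def)
  have "distinct vs" "vs \<noteq> []" using vs by (auto simp: P_def)
  have nth_eq: "vs ! a = vs ! b \<longleftrightarrow> a = b" if "a < ?n" "b < ?n" for a b
    using \<open>distinct vs\<close> that by (simp add: nth_eq_iff_index_eq)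
  have inner_nbr: "w = vs ! (k - 1) \<or> w = vs ! Suc k"
    if "0 < k" "Suc k < ?n" "(vs ! k, w) \<in> E" for k w
  proof -
    have "(vs ! k, vs ! (k - 1)) \<in> E" "(vs ! k, vs ! Suc k) \<in> E" "vs ! (k - 1) \<noteq> vs ! Suc k"
      using that step[of "k - 1"] step[of k] nth_eq[of "k - 1" "Suc k"] by auto
    then show ?thesis using that no_claw by metis
  qed
  have set: "set vs = I"
  proof (rule conn)
    fix u w assume "u \<in> set vs" and uw: "(u, w) \<in> E"
    then obtain k where k: "k < ?n" "u = vs ! k" by (auto simp: in_set_conv_nth)
    show "w \<in> set vs"
    proof (rule ccontr)
      assume w: "w \<notin> set vs"
      have "w \<in> I" using uw \<open>E \<subseteq> I \<times> I\<close> by blast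
      consider "k = 0" | "Suc k = ?n" | "0 < k" "Suc k < ?n" using k by linarith
      then show False
      proof cases
        case 1
        have "P (w # vs)"
          using vs w \<open>w \<in> I\<close> uw k 1 sym by (auto simp: P_def nth_Cons split: nat.splits)
        then show False using longest by fastforce
      next
        case 2
        then have "(vs ! m, w) \<in> E" if "Suc m = ?n" for m
          using uw k that by (metis nat.inject)
        then have "P (vs @ [w])"
          using vs w \<open>w \<in> I\<close> by (auto simp: P_def nth_append less_Suc_eq)
        then show False using longest by fastforce
      next
        case 3
        then show False using inner_nbr uw k w by (metis Suc_lessD less_imp_diff_less nth_mem)
      qed
    qed
  qed (use vs in \<open>auto simp: P_def\<close>)
  define Q where
    "Q = {(vs ! k, vs ! Suc k) | k. Suc k < ?n} \<union> {(vs ! Suc k, vs ! k) | k. Suc k < ?n}"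
  have "Q \<subseteq> E" using step by (auto simp: Q_def)
  show ?thesis
  proof (cases "E = Q")
    case True
    then show ?thesis using path[of vs] \<open>distinct vs\<close> \<open>vs \<noteq> []\<close> set unfolding Q_def by blast
  next
    case False
    with \<open>Q \<subseteq> E\<close> obtain u w where uw: "(u, w) \<in> E" "(u, w) \<notin> Q" by auto
    have "u \<in> I" "w \<in> I" using uw \<open>E \<subseteq> I \<times> I\<close> by auto
    then obtain a b where ab: "u = vs ! a" "w = vs ! b" "a < ?n" "b < ?n"
      using set by (metis in_set_conv_nth)
    have "a \<noteq> b" using uw ab \<open>irrefl E\<close> by (auto simp: irrefl_def)
    \<comment> \<open>The sorted positions of the extra edge. Inner vertices have no room for it, so
      \<open>p\<close> is the first position and \<open>q\<close> the last.\<close>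
    define p q where "p = min a b" and "q = max a b"
    have "(vs ! k, vs ! Suc k) \<in> Q" "(vs ! Suc k, vs ! k) \<in> Q" if "Suc k < ?n" for k
      using that by (auto simp: Q_def)
    then have nQ: "b \<noteq> Suc a" "a \<noteq> Suc b" using uw ab by auto
    have pq: "(vs ! p, vs ! q) \<in> E" "p < q" "q < ?n"
      using uw ab \<open>a \<noteq> b\<close> sym by (auto simp: p_def q_def min_def max_def)
    have "q \<noteq> Suc p"
      using nQ by (auto simp: p_def q_def min_def max_def)
    have "p = 0"
      using inner_nbr[of p "vs ! q"] pq \<open>q \<noteq> Suc p\<close> nth_eq[of q "p - 1"] nth_eq[of q "Suc p"]
      by fastforce
    have "Suc q = ?n"
    proof (rule ccontr)
      assume "Suc q \<noteq> ?n"
      then show False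
        using inner_nbr[of q "vs ! p"] pq \<open>q \<noteq> Suc p\<close> nth_eq[of p "q - 1"] nth_eq[of p "Suc q"]
          sym by fastforce
    qed
    show ?thesis
    proof (rule deg)
      fix i assume "i \<in> I"
      then obtain k where k: "k < ?n" "i = vs ! k" using set by (metis in_set_conv_nth)
      have ends: "(vs ! 0, vs ! q) \<in> E" "(vs ! q, vs ! 0) \<in> E" "1 < q"
        using pq \<open>p = 0\<close> \<open>q \<noteq> Suc p\<close> sym by auto
      consider "k = 0" | "k = q" | "0 < k" "Suc k < ?n"
        using k \<open>Suc q = ?n\<close> by linarith
      then show "\<exists>x y. (i, x) \<in> E \<and> (i, y) \<in> E \<and> x \<noteq> y"
      proof cases
        case 1
        then show ?thesis
          using step[of 0] ends nth_eq[of 1 q] pq k by (intro exI[of _ "vs ! 1"] exI[of _ "vs ! q"]) auto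
      next
        case 2
        then show ?thesis
          using step[of "q - 1"] ends nth_eq[of 0 "q - 1"] pq k \<open>vs \<noteq> []\<close> less_imp_diff_less[of q ?n 1]
          by (intro exI[of _ "vs ! 0"] exI[of _ "vs ! (q - 1)"]) auto
      next
        case 3
        then show ?thesis
          using step[of k] step[of "k - 1"] nth_eq[of "Suc k" "k - 1"] k
          by (intro exI[of _ "vs ! Suc k"] exI[of _ "vs ! (k - 1)"]) auto
      qed
    qed
  qed
qed

section \<open>Fusions of symmetric association schemes\<close>

locale symmetric_scheme =
  fixes d :: nat and A :: "nat \<Rightarrow> real ^ 'x ^ 'x :: finite"
  assumes scheme: "association_scheme d A"
begin

lemma A_0: "A 0 = mat 1"
  and A_sum: "(\<Sum>i\<le>d. A i) = (\<chi> x y. 1)"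
  and A_entry: "i \<le> d \<Longrightarrow> A i $ x $ y \<in> {0, 1}"
  and A_nonzero: "i \<le> d \<Longrightarrow> A i \<noteq> 0"
  and A_transpose: "i \<le> d \<Longrightarrow> transpose (A i) = A i"
  and A_mult: "\<exists>p. \<forall>i\<le>d. \<forall>j\<le>d. A i ** A j = (\<Sum>h\<le>d. p i j h *\<^sub>R A h)"
  using scheme unfolding association_scheme_def by blast+

text \<open>The Bose-Mesner algebra of the scheme.\<close>

definition V :: "(real ^ 'x ^ 'x) set" where
  "V = span (A ` {..d})"

lemma A_in_V: "i \<le> d \<Longrightarrow> A i \<in> V"
  by (auto simp: V_def intro: span_base)

lemma V_mult: "X \<in> V \<Longrightarrow> Y \<in> V \<Longrightarrow> X ** Y \<in> V"
  unfolding V_def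
proof (rule span_matrix_mult_closed)
  fix X Y assume "X \<in> A ` {..d}" "Y \<in> A ` {..d}"
  moreover have "A i ** A j \<in> span (A ` {..d})" if "i \<le> d" "j \<le> d" for i j
  proof -
    obtain p where "\<forall>i\<le>d. \<forall>j\<le>d. A i ** A j = (\<Sum>h\<le>d. p i j h *\<^sub>R A h)"
      using A_mult by (elim exE)
    then have eq: "A i ** A j = (\<Sum>h\<le>d. p i j h *\<^sub>R A h)" using that by simp
    show ?thesis unfolding eq by (intro span_sum span_scale span_base) auto
  qed
  ultimately show "X ** Y \<in> span (A ` {..d})" by auto
qed

sublocale symmetric_matrix_algebra V
proof
  show "subspace V" by (simp add: V_def)
  show "mat 1 \<in> V" using A_in_V[of 0] by (simp add: A_0)
  have "subspace {X :: real ^ 'x ^ 'x. transpose X = X}"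
    by (auto simp: subspace_def transpose_def vec_eq_iff)
  then have "V \<subseteq> {X. transpose X = X}"
    unfolding V_def by (rule span_minimal[rotated]) (auto simp: A_transpose)
  then show "transpose X = X" if "X \<in> V" for X using that by blast
qed (rule V_mult)

lemma A_unique_entry:
  obtains l where "l \<le> d" "\<And>m. m \<le> d \<Longrightarrow> A m $ x $ y = (if m = l then 1 else 0)"
proof -
  have sum: "(\<Sum>i\<le>d. A i $ x $ y) = 1"
    using arg_cong[OF A_sum, of "\<lambda>M. M $ x $ y"] by simp
  then obtain l where l: "l \<le> d" "A l $ x $ y \<noteq> 0"
    by (metis (no_types, lifting) atMost_iff sum.neutral zero_neq_one)
  then have l1: "A l $ x $ y = 1" using A_entry[of l x y] by simp
  have "A m $ x $ y = 0" if "m \<le> d" "m \<noteq> l" for m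
  proof -
    have "(\<Sum>i\<in>{l, m}. A i $ x $ y) \<le> (\<Sum>i\<le>d. A i $ x $ y)"
      using A_entry[of _ x y] that l by (intro sum_mono2) (fastforce+)
    then have "A m $ x $ y \<le> 0" using sum l1 that by simp
    then show ?thesis using A_entry[of m x y] that by auto
  qed
  then show ?thesis using that[of l] l l1 by auto
qed

lemma A_orthogonal:
  assumes "i \<le> d" "j \<le> d" "i \<noteq> j"
  shows "A i \<bullet> A j = 0"
proof -
  have *: "A i $ x $ y \<bullet> A j $ x $ y = 0" for x y
  proof -
    obtain l where "\<And>m. m \<le> d \<Longrightarrow> A m $ x $ y = (if m = l then 1 else 0)"
      using A_unique_entry[of x y] by blast
    then show ?thesis using assms by auto
  qed
  show ?thesis unfolding inner_vec_def * by simp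
qed

text \<open>Scaled to be dual to the \<open>A i\<close>: for \<open>X\<close> in \<open>V\<close>,
  the number \<open>X \<bullet> K i\<close> is the coefficient of \<open>A i\<close> in
  \<open>X\<close>.\<close>

definition K :: "nat \<Rightarrow> real ^ 'x ^ 'x" where
  "K i = (1 / (A i \<bullet> A i)) *\<^sub>R A i"

lemma A_inner_K:
  assumes "i \<le> d" "j \<le> d"
  shows "A i \<bullet> K j = (if i = j then 1 else 0)"
  using assms A_orthogonal A_nonzero by (simp add: K_def)

lemma K_in_V: "i \<le> d \<Longrightarrow> K i \<in> V"
  using A_in_V subspace by (simp add: K_def subspace_scale)

sublocale dual_orthogonal_families K "{1..d}" atoms
  using A_orthogonal A_nonzero atoms_orthogonal atoms_nonzero
  by unfold_locales (auto simp: K_def)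

lemma V_expand:
  assumes "X \<in> V"
  shows "X = (\<Sum>l\<le>d. (X \<bullet> K l) *\<^sub>R A l)"
  using assms unfolding V_def
proof (induction rule: span_induct_alt)
  case base then show ?case by simp
next
  case (step c x y)
  then obtain i where i: "i \<le> d" "x = A i" by auto
  have "(\<Sum>l\<le>d. ((c *\<^sub>R x + y) \<bullet> K l) *\<^sub>R A l) =
      (\<Sum>l\<le>d. (if i = l then c else 0) *\<^sub>R A l) + (\<Sum>l\<le>d. (y \<bullet> K l) *\<^sub>R A l)"
    unfolding sum.distrib[symmetric]
    by (intro sum.cong) (auto simp: i A_inner_K inner_add_left scaleR_add_left)
  also have "(\<Sum>l\<le>d. (if i = l then c else 0) *\<^sub>R A l) = c *\<^sub>R x"
    using i by (simp add: if_distrib[of "\<lambda>t. t *\<^sub>R _"] cong: if_cong)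
  finally show ?case using step by simp
qed

text \<open>The Bose-Mesner algebra of the fused scheme is the hyperplane of \<open>V\<close> on
  which the coefficients of \<open>A i\<close> and \<open>A j\<close> agree. Being closed under
  multiplication, it yields two atoms.\<close>

lemma pair_fuses_imp_adj:
  assumes "pair_fuses d A i j" "i \<in> {1..d}" "j \<in> {1..d}" "i \<noteq> j"
  shows "adj i j"
proof -
  define R where "R = insert (A i + A j) (A ` ({..d} - {i, j}))"
  obtain d' A' where "association_scheme d' A'" and R: "R = A' ` {..d'}"
    using assms(1) by (auto simp: pair_fuses_def is_association_scheme_def R_def)
  then interpret R: symmetric_scheme d' A' by unfold_locales
  have "R.V = span R" by (simp add: R.V_def R)
  have ij: "i \<le> d" "j \<le> d" "i \<noteq> 0" "j \<noteq> 0" using assms by auto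
  have hyperplane: "span R = {X \<in> V. X \<bullet> (K i - K j) = 0}"
  proof
    have "subspace {X \<in> V. X \<bullet> (K i - K j) = 0}"
      using subspace by (auto simp: subspace_def inner_add_left)
    moreover have "R \<subseteq> {X \<in> V. X \<bullet> (K i - K j) = 0}"
      using ij \<open>i \<noteq> j\<close> subspace A_in_V
      by (auto simp: R_def A_inner_K inner_add_left inner_diff_right subspace_add)
    ultimately show "span R \<subseteq> {X \<in> V. X \<bullet> (K i - K j) = 0}" by (rule span_minimal[rotated])
  next
    show "{X \<in> V. X \<bullet> (K i - K j) = 0} \<subseteq> span R"
    proof
      fix X assume "X \<in> {X \<in> V. X \<bullet> (K i - K j) = 0}"
      then have X: "X \<in> V" "X \<bullet> K i = X \<bullet> K j" by (auto simp: inner_diff_right)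
      have "X = (\<Sum>l\<in>{..d} - {i, j}. (X \<bullet> K l) *\<^sub>R A l) + (\<Sum>l\<in>{i, j}. (X \<bullet> K l) *\<^sub>R A l)"
        using ij by (subst V_expand[OF X(1)], intro sum.subset_diff) auto
      also have "(\<Sum>l\<in>{i, j}. (X \<bullet> K l) *\<^sub>R A l) = (X \<bullet> K j) *\<^sub>R (A i + A j)"
        using \<open>i \<noteq> j\<close> X by (simp add: scaleR_add_right)
      also have "(\<Sum>l\<in>{..d} - {i, j}. (X \<bullet> K l) *\<^sub>R A l) + \<dots> \<in> span R"
        by (intro span_add span_sum span_scale span_base) (auto simp: R_def)
      finally show "X \<in> span R" .
    qed
  qed
  obtain G H c where "G \<in> atoms" "H \<in> atoms" "K i - K j = c *\<^sub>R (G - H)"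
  proof (rule atoms_if_hyperplane_closed)
    show "K i - K j \<in> V" using ij K_in_V subspace by (simp add: subspace_diff)
    show "K i - K j \<noteq> 0" using K_inj assms by simp
    \<comment> \<open>\<open>mat 1\<close> is \<open>A 0\<close>, whose coefficients at the nonzero
      indices \<open>i\<close> and \<open>j\<close> vanish.\<close>
    show "(K i - K j) \<bullet> mat 1 = 0"
      using ij A_inner_K[of 0] by (simp add: A_0[symmetric] inner_commute[of _ "A 0"] inner_diff_right)
    show "(X ** Y) \<bullet> (K i - K j) = 0"
      if "X \<in> V" "Y \<in> V" "X \<bullet> (K i - K j) = 0" "Y \<bullet> (K i - K j) = 0" for X Y
      using R.V_mult[of X Y] that hyperplane \<open>R.V = span R\<close> by auto
  qed
  then show ?thesis using assms unfolding adj_def diff_repr_def by blast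
qed

section \<open>From adjacent indices to fusion schemes\<close>

lemma adj_mult_closed:
  assumes "adj i j" "X \<in> V" "Y \<in> V" "X \<bullet> K i = X \<bullet> K j" "Y \<bullet> K i = Y \<bullet> K j"
  shows "(X ** Y) \<bullet> K i = (X ** Y) \<bullet> K j"
proof -
  obtain G H c where "G \<in> atoms" "H \<in> atoms" "K i - K j = c *\<^sub>R (G - H)"
    using assms(1) unfolding adj_def diff_repr_def by blast
  from hyperplane_closed_if_atoms[OF this assms(2,3)] show ?thesis
    using assms(4,5) by (simp add: inner_diff_right)
qed

text \<open>The members of \<open>V\<close> with coefficients constant on blocks form the span of
  the block sums \<open>C S\<close>. Their closure under multiplication supplies the structure
  constants, read off at a representative \<open>r S\<close> of each block.\<close>

lemma fusion_scheme:
  assumes P: "partition_on {..d} P" "{0} \<in> P"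
    and closed: "\<And>S X Y i j. S \<in> P \<Longrightarrow> i \<in> S \<Longrightarrow> j \<in> S \<Longrightarrow> X \<in> V \<Longrightarrow> Y \<in> V \<Longrightarrow>
      X \<bullet> K i = X \<bullet> K j \<Longrightarrow> Y \<bullet> K i = Y \<bullet> K j \<Longrightarrow> (X ** Y) \<bullet> K i = (X ** Y) \<bullet> K j"
  shows "is_association_scheme ((\<lambda>S. \<Sum>l\<in>S. A l) ` P)"
proof -
  define C where "C S = (\<Sum>l\<in>S. A l)" for S
  define D where "D = {X \<in> V. \<forall>S\<in>P. \<forall>i\<in>S. \<forall>j\<in>S. X \<bullet> K i = X \<bullet> K j}"
  have "finite P" using P finite_elements by blast
  have sub: "S \<subseteq> {..d}" if "S \<in> P" for S using that P by (auto simp: partition_on_def)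
  have fin: "finite S" if "S \<in> P" for S using sub[OF that] finite_subset by blast
  have ne: "S \<noteq> {}" if "S \<in> P" for S using that P by (auto simp: partition_on_def)
  have disj: "S \<inter> T = {}" if "S \<in> P" "T \<in> P" "S \<noteq> T" for S T
    using that P by (auto simp: partition_on_def disjoint_def)
  have CK: "C S \<bullet> K l = (if l \<in> S then 1 else 0)" if "S \<in> P" "l \<le> d" for S l
  proof -
    have "C S \<bullet> K l = (\<Sum>m\<in>S. if m = l then 1 else 0)"
      unfolding C_def inner_sum_left using sub[OF that(1)] that
      by (intro sum.cong) (auto simp: A_inner_K)
    then show ?thesis using fin[OF that(1)] by simp
  qed
  have CD: "C S \<in> D" if "S \<in> P" for S
  proof -
    have "C S \<in> V" unfolding C_def using sub[OF that] subspace A_in_V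
      by (intro subspace_sum) auto
    moreover have "C S \<bullet> K i = C S \<bullet> K j" if "T \<in> P" "i \<in> T" "j \<in> T" for T i j
    proof -
      have "i \<le> d" "j \<le> d" using sub that by auto
      then show ?thesis using CK[OF \<open>S \<in> P\<close>] disj[OF \<open>S \<in> P\<close> \<open>T \<in> P\<close>] that by auto
    qed
    ultimately show ?thesis unfolding D_def by blast
  qed
  have D_mult: "X ** Y \<in> D" if "X \<in> D" "Y \<in> D" for X Y
  proof -
    have V: "X \<in> V" "Y \<in> V" using that by (simp_all add: D_def)
    have "(X ** Y) \<bullet> K i = (X ** Y) \<bullet> K j" if "S \<in> P" "i \<in> S" "j \<in> S" for S i j
    proof (rule closed[OF that V])
      show "X \<bullet> K i = X \<bullet> K j" "Y \<bullet> K i = Y \<bullet> K j"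
        using \<open>X \<in> D\<close> \<open>Y \<in> D\<close> that unfolding D_def by blast+
    qed
    then show ?thesis using V_mult[OF V] unfolding D_def by blast
  qed
  define r where "r S = (SOME l. l \<in> S)" for S :: "nat set"
  have r: "r S \<in> S" if "S \<in> P" for S using ne[OF that] by (simp add: r_def some_in_eq)
  have Un: "{..d} = \<Union>P" using P by (simp add: partition_on_def)
  have expand: "X = (\<Sum>S\<in>P. (X \<bullet> K (r S)) *\<^sub>R C S)" if "X \<in> D" for X
  proof -
    have "X = (\<Sum>l\<in>\<Union>P. (X \<bullet> K l) *\<^sub>R A l)"
      unfolding Un[symmetric] using that by (intro V_expand) (simp add: D_def)
    also have "\<dots> = (\<Sum>S\<in>P. \<Sum>l\<in>S. (X \<bullet> K l) *\<^sub>R A l)"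
      using fin disj by (subst sum.Union_disjoint) auto
    also have "\<dots> = (\<Sum>S\<in>P. (X \<bullet> K (r S)) *\<^sub>R C S)"
    proof (rule sum.cong)
      fix S assume S: "S \<in> P"
      have "X \<bullet> K l = X \<bullet> K (r S)" if "l \<in> S" for l
        using \<open>X \<in> D\<close> S that r[OF S] unfolding D_def by blast
      then show "(\<Sum>l\<in>S. (X \<bullet> K l) *\<^sub>R A l) = (X \<bullet> K (r S)) *\<^sub>R C S"
        by (simp add: C_def scaleR_sum_right)
    qed simp
    finally show ?thesis .
  qed
  \<comment> \<open>The class count omits the trivial block, which \<open>f\<close> puts at index 0
    ahead of an enumeration of the others.\<close>
  define n where "n = card (P - {{0}})"
  obtain h where h: "bij_betw h {0..<n} (P - {{0}})"
    using ex_bij_betw_nat_finite[of "P - {{0}}"] \<open>finite P\<close> by (auto simp: n_def)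
  define f where "f m = (case m of 0 \<Rightarrow> {0} | Suc k \<Rightarrow> h k)" for m
  have f: "bij_betw f {..n} P"
  proof -
    have *: "{..n} = insert 0 (Suc ` {0..<n})" by (auto simp: image_iff)
    have fS: "f \<circ> Suc = h" and f0: "f 0 = {0}" by (auto simp: f_def)
    have inj: "inj_on f (Suc ` {0..<n})"
      using bij_betw_imp_inj_on[OF h] by (intro inj_on_imageI) (simp only: fS)
    have img: "f ` Suc ` {0..<n} = P - {{0}}"
      using bij_betw_imp_surj_on[OF h] by (simp only: image_comp fS)
    then have "f 0 \<notin> f ` Suc ` {0..<n}" by (simp only: f0 Diff_iff singleton_iff simp_thms)
    moreover have "Suc ` {0..<n} - {0} = Suc ` {0..<n}" by auto
    ultimately have "inj_on f {..n}" using inj by (simp only: * inj_on_insert simp_thms)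
    moreover have "f ` {..n} = P"
      unfolding * image_insert img f0 using P(2) by (simp only: insert_Diff)
    ultimately show ?thesis by (rule bij_betw_imageI)
  qed
  then have fP: "f m \<in> P" if "m \<le> n" for m using that by (auto simp: bij_betw_def)
  have "association_scheme n (\<lambda>m. C (f m))"
    unfolding association_scheme_def
  proof (intro conjI allI impI)
    fix m x y assume "m \<le> n"
    obtain l where l: "\<And>k. k \<le> d \<Longrightarrow> A k $ x $ y = (if k = l then 1 else 0)"
      using A_unique_entry[of x y] by blast
    have "C (f m) $ x $ y = (\<Sum>k\<in>f m. if k = l then 1 else 0)"
      unfolding C_def sum_component using sub[OF fP[OF \<open>m \<le> n\<close>]] l by (intro sum.cong) auto
    then show "C (f m) $ x $ y \<in> {0, 1}" using fin[OF fP[OF \<open>m \<le> n\<close>]] by simp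
  next
    fix m assume m: "m \<le> n"
    show "C (f m) \<noteq> 0"
      using CK[OF fP[OF m], of "r (f m)"] r[OF fP[OF m]] sub[OF fP[OF m]] by auto
    show "transpose (C (f m)) = C (f m)"
      using CD[OF fP[OF m]] symmetric by (simp add: D_def)
  next
    show "C (f 0) = mat 1" by (simp add: C_def f_def A_0)
  next
    have "(\<Sum>m\<le>n. C (f m)) = (\<Sum>S\<in>P. C S)" using f by (rule sum.reindex_bij_betw)
    also have "\<dots> = (\<Sum>l\<in>\<Union>P. A l)"
      unfolding C_def using fin disj by (subst sum.Union_disjoint) auto
    finally show "(\<Sum>m\<le>n. C (f m)) = (\<chi> x y. 1)" by (simp add: Un[symmetric] A_sum)
  next
    have "C (f a) ** C (f b) = (\<Sum>h\<le>n. ((C (f a) ** C (f b)) \<bullet> K (r (f h))) *\<^sub>R C (f h))"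
      if "a \<le> n" "b \<le> n" for a b
    proof -
      have "C (f a) ** C (f b) \<in> D" using D_mult CD fP that by blast
      from expand[OF this] show ?thesis
        using sum.reindex_bij_betw[OF f, of "\<lambda>S. ((C (f a) ** C (f b)) \<bullet> K (r S)) *\<^sub>R C S"]
        by simp
    qed
    then show "\<exists>p. \<forall>a\<le>n. \<forall>b\<le>n. C (f a) ** C (f b) = (\<Sum>h\<le>n. p a b h *\<^sub>R C (f h))"
      by (intro exI[of _ "\<lambda>a b h. (C (f a) ** C (f b)) \<bullet> K (r (f h))"]) blast
  qed
  moreover have "(\<lambda>S. \<Sum>l\<in>S. A l) ` P = (\<lambda>m. C (f m)) ` {..n}"
    using f by (auto simp: C_def bij_betw_def image_image[symmetric])
  ultimately show ?thesis unfolding is_association_scheme_def by blast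
qed

text \<open>A block other than \<open>{0}\<close> avoids 0, so its indices are pairwise adjacent and
  each equality of their coefficients cuts out a subalgebra.\<close>

lemma complete_imp_amorphic:
  assumes "\<And>i j. i \<in> {1..d} \<Longrightarrow> j \<in> {1..d} \<Longrightarrow> i \<noteq> j \<Longrightarrow> adj i j"
  shows "amorphic d A"
  unfolding amorphic_def
proof (intro allI impI, elim conjE)
  fix P assume P: "partition_on {..d} P" "{0} \<in> P"
  then show "is_association_scheme ((\<lambda>S. \<Sum>l\<in>S. A l) ` P)"
  proof (rule fusion_scheme)
    fix S X Y i j
    assume *: "S \<in> P" "i \<in> S" "j \<in> S" "X \<in> V" "Y \<in> V" "X \<bullet> K i = X \<bullet> K j" "Y \<bullet> K i = Y \<bullet> K j"
    show "(X ** Y) \<bullet> K i = (X ** Y) \<bullet> K j"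
    proof (cases "i = j")
      case False
      then have "S \<noteq> {0}" using * by auto
      then have "S \<inter> {0} = {}" using disjointD[OF partition_onD2[OF P(1)] *(1) P(2)] by simp
      moreover have "S \<subseteq> {..d}" using partition_onD1[OF P(1)] *(1) by blast
      ultimately have "S \<subseteq> {1..d}" by (auto simp: Suc_le_eq intro: gr0I)
      then have "adj i j" using assms *(2,3) False by blast
      from adj_mult_closed[OF this *(4-7)] show ?thesis .
    qed simp
  qed
qed

end

section \<open>Application to the fusing-relations graph\<close>

lemma fusing_graph_connectedD:
  assumes conn: "Digraph_Component.connected (with_proj (fusing_graph d A))"
    and S: "S \<subseteq> {1..d}" "S \<noteq> {}"
    and closed: "\<And>i j. i \<in> S \<Longrightarrow> (i, j) \<in> parcs (fusing_graph d A) \<Longrightarrow> j \<in> S"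
  shows "S = {1..d}"
proof
  show "{1..d} \<subseteq> S"
  proof
    fix t assume t: "t \<in> {1..d}"
    let ?M = "mk_symmetric (with_proj (fusing_graph d A))"
    obtain s where "s \<in> S" using S by blast
    then have "(s, t) \<in> rtrancl_on {1..d} (parcs ?M)"
      using conn t S
      by (auto simp: connected_def strongly_connected_def reachable_def fusing_graph_def)
    then show "t \<in> S"
    proof (induction rule: rtrancl_on_induct)
      case base then show ?case using \<open>s \<in> S\<close> by simp
    next
      case (step y z)
      \<comment> \<open>Fusing is symmetric in the pair, so the symmetric closure used for
        connectivity adds no arcs.\<close>
      have "(y, z) \<in> parcs (fusing_graph d A)"
        using step(2) by (auto simp: parcs_mk_symmetric fusing_graph_def pair_fuses_def
            add.commute insert_commute)
      then show ?case using closed step by blast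
    qed
  qed
qed (use S in blast)

theorem theorem6p3:
  fixes A :: "nat \<Rightarrow> real ^ 'x ^ 'x :: finite" and d :: nat
  assumes "association_scheme d A"
    and "d \<ge> 3"
    and "Digraph_Component.connected (with_proj (fusing_graph d A))"
    and "\<not> is_path_graph (fusing_graph d A)"
  shows "amorphic d A"
proof -
  interpret symmetric_scheme d A using assms(1) by unfold_locales
  let ?E = "parcs (fusing_graph d A)"
  have E: "adj i j" if "(i, j) \<in> ?E" for i j
    using that pair_fuses_imp_adj by (auto simp: fusing_graph_def)
  have conn: "S = {1..d}"
    if "S \<subseteq> {1..d}" "S \<noteq> {}" "\<And>i j. i \<in> S \<Longrightarrow> adj i j \<Longrightarrow> j \<in> S" for S
    using assms(3) that(1,2) by (rule fusing_graph_connectedD) (use that(3) E in blast)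
  \<comment> \<open>The trichotomy is applied to the fusing-relations graph itself, which is not a
    path. The other two cases pass to \<open>adj\<close>, which contains its edges and inherits its
    connectivity.\<close>
  have "adj p q" if pq: "p \<in> {1..d}" "q \<in> {1..d}" "p \<noteq> q" for p q
  proof (rule connected_path_or_claw_or_min_degree_two[of "{1..d}" ?E])
    show "?E \<subseteq> {1..d} \<times> {1..d}" "irrefl ?E" by (auto simp: fusing_graph_def irrefl_def)
    show "sym ?E"
      by (auto simp: fusing_graph_def sym_def pair_fuses_def add.commute insert_commute)
    show "S = {1..d}"
      if "S \<subseteq> {1..d}" "S \<noteq> {}" "\<And>i j. i \<in> S \<Longrightarrow> (i, j) \<in> ?E \<Longrightarrow> j \<in> S" for S
      using assms(3) that by (rule fusing_graph_connectedD)
  next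
    fix vs assume vs: "vs \<noteq> []" "distinct vs" "set vs = {1..d}"
      "?E = {(vs ! k, vs ! Suc k) | k. Suc k < length vs} \<union>
            {(vs ! Suc k, vs ! k) | k. Suc k < length vs}"
    have "set vs = pverts (fusing_graph d A)" using vs(3) by (simp add: fusing_graph_def)
    then have "is_path_graph (fusing_graph d A)"
      unfolding is_path_graph_def by (intro exI[of _ vs] conjI vs)
    then show ?thesis using assms(4) by simp
  next
    fix v x y z assume *: "(v, x) \<in> ?E" "(v, y) \<in> ?E" "(v, z) \<in> ?E" "x \<noteq> y" "x \<noteq> z" "y \<noteq> z"
    show ?thesis
      by (rule claw_complete[OF _ E[OF *(1)] E[OF *(2)] E[OF *(3)] *(4-6) pq]) (rule conn)
  next
    assume "\<And>i. i \<in> {1..d} \<Longrightarrow> \<exists>x y. (i, x) \<in> ?E \<and> (i, y) \<in> ?E \<and> x \<noteq> y"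
    then have deg: "\<And>i. i \<in> {1..d} \<Longrightarrow> \<exists>x y. adj i x \<and> adj i y \<and> x \<noteq> y" using E by blast
    show ?thesis
      by (rule min_degree_two_complete[OF _ deg finite_atLeastAtMost pq]) (rule conn)
  qed (use assms(2) in auto)
  then show ?thesis by (rule complete_imp_amorphic)
qed

end
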